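(* Let $f\in\mathbb{R}[x_1,\dots,x_n]$ have degree $d$, let $G(x)$ be an $m\times m$ symmetric polynomial matrix with $l=\lceil\deg(G)/2\rceil\ge1$, let $B^n$ be the closed unit ball of $\mathbb{R}^n$, and let $\mathcal{X}=\{x\in B^n:G(x)\succeq0\}$, assumed nonempty, with $f_{\min}=\min_{x\in\mathcal{X}}f(x)$. Assume that the spectral radius of $G(x)$ is at most $1$ for all $x\in B^n$. Let $L_f$ be the Lipschitz constant of $f$ over $B^n$, and let $C>0$ and $0<L\le1$ be Łojasiewicz constant and exponent for $\mathcal{X}$ on $B^n$, i.e. $\mathrm{dist}(x,\mathcal{X})\le C\max\{0,-\lambda_m(x)\}^L$ for all $x\in B^n$, where $\lambda_m(x)$ is the smallest eigenvalue of $G(x)$. Let $\delta\in(0,1]$. Then for any positive integers $r$ and $v$ such that $r\ge2n\max\{d,2l(v+1)\}$, $\mathrm{lb}(f,\overline{\mathcal{Q}}(\mathcal{X}))_r$ is a lower bound of $f_{\min}$ satisfying $$f_{\min}-\mathrm{lb}(f,\overline{\mathcal{Q}}(\mathcal{X}))_r\le2\Big(\|f\|_{B^n}\big(1+\tfrac{m}{\delta}\big)+U(m,v,\delta)\Big)\cdot\frac{C_B(n,\max\{d,2l(v+1)\})}{r^2}+U(m,v,\delta)+CL_f\delta^L,$$ where $U(m,v,\delta)=16e^2m\,\|f\|_{B^n}\,\delta^{-1}a^{\delta v}$ and $a=e^{-1/(2e+1)}$.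
   Context: $\|f\|_{B^n}=\max_{x\in B^n}|f(x)|$; $\mathrm{dist}$ is Euclidean distance; $\deg G$ is the maximum degree of the entries of $G$. For $h(t)=\sum_ih_it^i\in\mathbb{R}[t]$, $h(G(x))=\sum_ih_iG(x)^i$ (with $G(x)^0=I_m$), and $\langle A,B\rangle=\mathrm{tr}(A^\top B)$. $\mathcal{Q}(B^n)_{2r}$ is the set of polynomials $\sigma_0+\sigma_1(1-\sum_ix_i^2)$ with $\sigma_0,\sigma_1$ sums of squares of polynomials, $\deg\sigma_0\le2r$, $\deg\sigma_1\le2r-2$. $\mathcal{H}(G)_k=\{\langle h(G(x)),G(x)\rangle:h\in\mathbb{R}[t],\ \deg h\le k,\ h(t)\ge0\ \forall t\in[-1,1]\}$. $\overline{\mathcal{Q}}(\mathcal{X})_{2r}=\mathcal{Q}(B^n)_{2r}+\mathcal{H}(G)_{\lfloor r/l\rfloor-1}$ and $\mathrm{lb}(f,\overline{\mathcal{Q}}(\mathcal{X}))_r=\max\{t\in\mathbb{R}:f-t\in\overline{\mathcal{Q}}(\mathcal{X})_{2r}\}$ (understood as a supremum). $C_B(n,D)$ is the constant, depending only on $n$ and $D$, of the following known theorem (Slot), which may be used: if $g\in\mathbb{R}[x_1,\dots,x_n]$ has degree at most $D$ and $r\ge2nD$, then $0\le\min_{B^n}g-\mathrm{lb}(g,\mathcal{Q}(B^n))_r\le\frac{C_B(n,D)}{r^2}\,(\max_{B^n}g-\min_{B^n}g)$, where $\mathrm{lb}(g,\mathcal{Q}(B^n))_r=\max\{t:g-t\in\mathcal{Q}(B^n)_{2r}\}$.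 *)

theory Defs
  imports
    "HOL-Analysis.Analysis"
    "HOL-Computational_Algebra.Polynomial"
    "HOL-Library.Poly_Mapping"
    "HOL-Library.Extended_Real"
begin

(* Real polynomials in the variables x_i, i :: 'n. The index type 'n is finite, so the number of
   variables is CARD('n). A monomial is its exponent map, and multiplication is that of the
   monoid algebra. *)
type_synonym 'n mpoly = "('n \<Rightarrow>\<^sub>0 nat) \<Rightarrow>\<^sub>0 real"

definition mconst :: "real \<Rightarrow> 'n mpoly" where
  "mconst c = Poly_Mapping.single 0 c"

definition mdeg :: "'n::finite mpoly \<Rightarrow> nat" where
  "mdeg p = Max (insert 0 ((\<lambda>\<alpha>. \<Sum>i\<in>UNIV. Poly_Mapping.lookup \<alpha> i) ` Poly_Mapping.keys p))"

definition meval :: "'n::finite mpoly \<Rightarrow> real^'n \<Rightarrow> real" where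
  "meval p x = (\<Sum>\<alpha>\<in>Poly_Mapping.keys p.
     Poly_Mapping.lookup p \<alpha> * (\<Prod>i\<in>UNIV. (x $ i) ^ Poly_Mapping.lookup \<alpha> i))"

definition mvar :: "'n \<Rightarrow> 'n mpoly" where
  "mvar i = Poly_Mapping.single (Poly_Mapping.single i 1) 1"


abbreviation unit_ball :: "(real^'n::finite) set" where
  "unit_ball \<equiv> cball 0 1"

(* Polynomials are continuous and the sets below are compact, so for nonempty sets the suprema
   and infima of polynomial functions written here are the usual maxima and minima. *)
definition min_on :: "(real^'n::finite) set \<Rightarrow> 'n mpoly \<Rightarrow> real" where
  "min_on S g = (INF x\<in>S. meval g x)"

definition max_on :: "(real^'n::finite) set \<Rightarrow> 'n mpoly \<Rightarrow> real" where
  "max_on S g = (SUP x\<in>S. meval g x)"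

definition ball_norm :: "'n::finite mpoly \<Rightarrow> real" where
  "ball_norm g = (SUP x\<in>unit_ball. \<bar>meval g x\<bar>)"


definition eigenvalue :: "'a::field^'m^'m \<Rightarrow> 'a \<Rightarrow> bool" where
  "eigenvalue A c \<longleftrightarrow> (\<exists>v. v \<noteq> 0 \<and> A *v v = c *s v)"

definition min_eigenvalue :: "real^'m^'m \<Rightarrow> real" where
  "min_eigenvalue A = Min {c. eigenvalue A c}"

definition spectral_radius :: "real^'m^'m \<Rightarrow> real" where
  "spectral_radius A = Max {cmod c | c. eigenvalue (map_matrix complex_of_real A) c}"

definition psd :: "real^'m^'m \<Rightarrow> bool" where
  "psd A \<longleftrightarrow> transpose A = A \<and> (\<forall>v. 0 \<le> v \<bullet> (A *v v))"

definition mat_deg :: "'n::finite mpoly^'m^'m \<Rightarrow> nat" where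
  "mat_deg G = Max {mdeg (G $ i $ j) | i j. True}"

definition mat_eval :: "'n::finite mpoly^'m^'m \<Rightarrow> real^'n \<Rightarrow> real^'m^'m" where
  "mat_eval G x = map_matrix (\<lambda>p. meval p x) G"

definition half_deg :: "'n::finite mpoly^'m^'m \<Rightarrow> nat" where
  "half_deg G = nat \<lceil>real (mat_deg G) / 2\<rceil>"

definition feasible_set :: "'n::finite mpoly^'m^'m \<Rightarrow> (real^'n) set" where
  "feasible_set G = {x \<in> unit_ball. psd (mat_eval G x)}"

(* The library's power on matrices would be componentwise. *)
primrec mat_pow :: "'a::semiring_1^'m^'m \<Rightarrow> nat \<Rightarrow> 'a^'m^'m" where
  "mat_pow A 0 = mat 1"
| "mat_pow A (Suc k) = A ** mat_pow A k"

definition poly_mat :: "real poly \<Rightarrow> 'n mpoly^'m^'m \<Rightarrow> 'n mpoly^'m^'m" where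
  "poly_mat h G = (\<Sum>i\<le>degree h. map_matrix (\<lambda>p. mconst (coeff h i) * p) (mat_pow G i))"

definition mat_inner :: "'a::comm_semiring_1^'m^'m \<Rightarrow> 'a^'m^'m \<Rightarrow> 'a" where
  "mat_inner A B = trace (transpose A ** B)"


definition sos :: "'n mpoly \<Rightarrow> bool" where
  "sos p \<longleftrightarrow> (\<exists>qs. p = (\<Sum>q\<leftarrow>qs. q ^ 2))"

(* The set Q(B^n)_{2r}. The zero polynomial has degree below every bound; this only matters
   for r = 0. *)
definition Q_ball :: "nat \<Rightarrow> 'n::finite mpoly set" where
  "Q_ball r = {\<sigma>0 + \<sigma>1 * (1 - (\<Sum>i\<in>UNIV. mvar i ^ 2)) | \<sigma>0 \<sigma>1.
     sos \<sigma>0 \<and> sos \<sigma>1 \<and> mdeg \<sigma>0 \<le> 2 * r \<and> (\<sigma>1 = 0 \<or> mdeg \<sigma>1 + 2 \<le> 2 * r)}"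

(* The set H(G)_k. The index is an integer since floor(r/l) - 1 is -1 for r < l; the zero
   polynomial again has degree below every bound. *)
definition H_mat :: "'n mpoly^'m^'m \<Rightarrow> int \<Rightarrow> 'n mpoly set" where
  "H_mat G k = {mat_inner (poly_mat h G) G | h.
     (h = 0 \<or> int (degree h) \<le> k) \<and> (\<forall>t\<in>{-1..1}. 0 \<le> poly h t)}"

definition Q_mat :: "'n::finite mpoly^'m^'m \<Rightarrow> nat \<Rightarrow> 'n mpoly set" where
  "Q_mat G r = {q + p | q p. q \<in> Q_ball r \<and> p \<in> H_mat G (\<lfloor>real r / real (half_deg G)\<rfloor> - 1)}"

(* The supremum is taken in the extended reals, so it is -\<infinity> if no t is admissible. *)
definition lb :: "'n mpoly \<Rightarrow> 'n mpoly set \<Rightarrow> ereal" where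
  "lb f Q = Sup {ereal t | t. f - mconst t \<in> Q}"


definition U_err :: "real \<Rightarrow> nat \<Rightarrow> nat \<Rightarrow> real \<Rightarrow> real" where
  "U_err M m v \<delta> =
     16 * exp 1 ^ 2 * real m * M * (1 / \<delta>) * exp (- 1 / (2 * exp 1 + 1)) powr (\<delta> * real v)"

end

theory Submission
  imports Defs
begin

text \<open>
  Choose a polynomial \<open>h\<close> of degree at most \<open>v\<close>, nonnegative on \<open>[-1, 1]\<close>, that is close to the step
  function with value \<open>2 \<parallel>f\<parallel> / \<delta>\<close> on \<open>[-1, -\<delta>]\<close> and \<open>0\<close> on \<open>[0, 1]\<close>, and replace \<open>f\<close> by
  \<open>g = f - \<langle>h(G), G\<rangle>\<close>. Diagonalising, \<open>\<langle>h(G), G\<rangle>\<close> is the sum of \<open>h(\<lambda>) \<lambda>\<close> over the eigenvalues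
  of \<open>G(x)\<close>. If some eigenvalue is below \<open>-\<delta>\<close>, the penalty lifts \<open>g\<close> above \<open>\<parallel>f\<parallel> - U\<close>;
  otherwise \<open>x\<close> is within \<open>C \<delta>\<^sup>L\<close> of the feasible set and the Lipschitz bound applies. So on the
  ball \<open>g \<ge> f\<^sub>m\<^sub>i\<^sub>n - U - C L\<^sub>f \<delta>\<^sup>L\<close>, and Slot's theorem for \<open>g\<close> gives the claim, because
  the certificates of \<open>g\<close> over the ball become certificates of \<open>f\<close> after adding
  \<open>\<langle>h(G), G\<rangle>\<close>. The step polynomial is the integral of a peaked kernel built from Chebyshev
  polynomials, whose contrast grows exponentially in \<open>\<delta> v\<close>.
\<close>

section \<open>Polynomial approximation of a step\<close>

text \<open>\<^term>\<open>fejer_poly n\<close> is \<open>(T\<^sub>n - 1) / (x - 1)\<close> for the Chebyshev polynomial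
  \<open>T\<^sub>n\<close>. The quotient by \<open>x - 1\<close> makes the kernel decay away from its peak, so that no
  factor \<open>1 / \<delta>\<close> is lost when its tails are integrated.\<close>
fun fejer_poly :: "nat \<Rightarrow> real poly" where
  "fejer_poly 0 = 0"
| "fejer_poly (Suc 0) = 1"
| "fejer_poly (Suc (Suc n)) = [:0, 2:] * fejer_poly (Suc n) - fejer_poly n + [:2:]"

lemma degree_fejer_poly: "degree (fejer_poly n) \<le> n - 1"
proof (induction n rule: fejer_poly.induct)
  case (3 n)
  have "degree ([:0, 2:] * fejer_poly (Suc n)) \<le> Suc n"
    using degree_mult_le[of "[:0, 2:]" "fejer_poly (Suc n)"] 3 by simp
  then show ?case using 3
    by (auto intro!: degree_add_le degree_diff_le)
qed auto

text \<open>The left side obeys the Chebyshev recursion, which for cosines is the sum of the two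
  addition formulas. The constant 2 in the recursion of \<open>fejer_poly\<close> is
  \<open>(2 * x - 2) / (x - 1)\<close>.\<close>

lemma fejer_poly_cos:
  "1 + (cos \<theta> - 1) * poly (fejer_poly n) (cos \<theta>) = cos (real n * \<theta>)"
proof (induction n rule: fejer_poly.induct)
  case (3 n)
  have "cos (real (Suc (Suc n)) * \<theta>) = cos (real (Suc n) * \<theta> + \<theta>)"
    "cos (real n * \<theta>) = cos (real (Suc n) * \<theta> - \<theta>)"
    by (simp_all add: algebra_simps)
  then have "cos (real (Suc (Suc n)) * \<theta>) = 2 * cos \<theta> * cos (real (Suc n) * \<theta>) - cos (real n * \<theta>)"
    by (simp only: cos_add cos_diff) (simp add: algebra_simps)
  then show ?case unfolding 3[symmetric] by (simp add: algebra_simps)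
qed auto

text \<open>The same recursion for cosh reaches arguments beyond 1, where the peak of the kernel is
  measured.\<close>

lemma fejer_poly_cosh:
  "1 + (cosh s - 1) * poly (fejer_poly n) (cosh s) = cosh (real n * s)" for s :: real
proof (induction n rule: fejer_poly.induct)
  case (3 n)
  have "cosh (real (Suc (Suc n)) * s) = cosh (real (Suc n) * s + s)"
    "cosh (real n * s) = cosh (real (Suc n) * s - s)"
    by (simp_all add: algebra_simps)
  then have "cosh (real (Suc (Suc n)) * s) = 2 * cosh s * cosh (real (Suc n) * s) - cosh (real n * s)"
    by (simp only: cosh_add cosh_diff) (simp add: algebra_simps)
  then show ?case unfolding 3[symmetric] by (simp add: algebra_simps)
qed auto

lemma fejer_poly_one: "poly (fejer_poly n) 1 = real n ^ 2"
  by (induction n rule: fejer_poly.induct) (auto simp: algebra_simps power2_eq_square)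

text \<open>The product is \<open>1 - cos (n * arccos w)\<close>. The resulting decay like
  \<open>1 / (1 - w)\<close> is what keeps the tails of the kernel small.\<close>

lemma fejer_poly_ge:
  assumes "\<bar>w\<bar> \<le> 1"
  shows "(1 - w) * poly (fejer_poly n) w \<le> 2" "0 \<le> (1 - w) * poly (fejer_poly n) w"
proof -
  have "1 + (w - 1) * poly (fejer_poly n) w = cos (real n * arccos w)"
    using fejer_poly_cos[of "arccos w" n] assms by (simp add: cos_arccos_abs)
  then have "(1 - w) * poly (fejer_poly n) w = 1 - cos (real n * arccos w)"
    by (simp add: algebra_simps)
  then show "(1 - w) * poly (fejer_poly n) w \<le> 2" "0 \<le> (1 - w) * poly (fejer_poly n) w"
    using cos_ge_minus_one[of "real n * arccos w"] by simp_all
qed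

text \<open>Left of 1 the value is \<open>1 - cos\<close> over \<open>1 - w\<close>, right of 1 it
  is \<open>cosh - 1\<close> over \<open>w - 1\<close>; at 1 both quotients degenerate and the
  explicit value takes over.\<close>

lemma fejer_poly_nonneg:
  assumes "-1 \<le> w"
  shows "0 \<le> poly (fejer_poly n) w"
proof -
  consider "w < 1" | "w = 1" | "w > 1" by linarith
  then show ?thesis
  proof cases
    case 1
    then show ?thesis using fejer_poly_ge(2)[of w n] assms by (simp add: zero_le_mult_iff)
  next
    case 3
    have "1 + (w - 1) * poly (fejer_poly n) w \<ge> 1"
      using fejer_poly_cosh[of "arcosh w" n] 3 cosh_real_ge_1[of "real n * arcosh w"] by simp
    then show ?thesis using 3 by (simp add: zero_le_mult_iff)
  qed (simp add: fejer_poly_one)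
qed

text \<open>Write \<open>w = cosh s\<close>. As
  \<open>cosh (2 * ln (1 + y)) = 1 + ((1 + y) - 1 / (1 + y)) ^ 2 / 2\<close> is at most
  \<open>1 + 2 * y ^ 2\<close>, s is at least \<open>2 * ln (1 + y)\<close>, and
  \<open>cosh (n * s)\<close> is at least half of \<open>exp (n * s)\<close>.\<close>

lemma fejer_poly_growth:
  assumes "0 \<le> y" "1 + 2 * y ^ 2 \<le> w"
  shows "(1 + y) ^ (2 * n) / 2 \<le> 1 + (w - 1) * poly (fejer_poly n) w"
proof -
  define s where "s = arcosh w"
  have w1: "1 \<le> w" using assms(2) zero_le_power2[of y] by linarith
  have s: "cosh s = w" "0 \<le> s" using w1 by (auto simp: s_def )
  have "cosh (2 * ln (1 + y)) = (exp (2 * ln (1 + y)) + exp (- (2 * ln (1 + y)))) / 2"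
    by (simp add: cosh_def)
  also have "\<dots> = ((1 + y) ^ 2 + (1 / (1 + y)) ^ 2) / 2"
    using assms(1) by (simp add: exp_double exp_minus field_simps)
  also have "\<dots> = 1 + ((1 + y) - 1 / (1 + y)) ^ 2 / 2"
  proof -
    have "(z ^ 2 + (1 / z) ^ 2) / 2 = 1 + (z - 1 / z) ^ 2 / 2" if "z \<noteq> 0" for z :: real
      using that by (simp add: power2_eq_square field_simps)
    from this[of "1 + y"] show ?thesis using assms(1) by simp
  qed
  also have "\<dots> \<le> 1 + (2 * y) ^ 2 / 2"
  proof -
    have "(1 + y) - 1 / (1 + y) \<le> 2 * y" "0 \<le> (1 + y) - 1 / (1 + y)"
      using assms(1) by (simp_all add: field_simps)
    then have "((1 + y) - 1 / (1 + y)) ^ 2 \<le> (2 * y) ^ 2" by (rule power_mono)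
    then show ?thesis by simp
  qed
  also have "\<dots> \<le> cosh s" using assms(2) s by (simp add: power_mult_distrib)
  finally have "2 * ln (1 + y) \<le> s"
    using s assms(1) by (subst (asm) cosh_real_nonneg_le_iff) auto
  then have "real n * (2 * ln (1 + y)) \<le> real n * s" by (rule mult_left_mono) simp
  then have "exp (real (2 * n) * ln (1 + y)) \<le> exp (real n * s)" by simp
  then have "(1 + y) ^ (2 * n) \<le> exp (real n * s)"
    unfolding exp_of_nat_mult using assms(1) by simp
  also have "\<dots> / 2 \<le> cosh (real n * s)" by (simp add: cosh_def)
  finally show ?thesis using fejer_poly_cosh[of s n] s by simp
qed

section \<open>From the kernel to its integral\<close>

lemma ex_poly_antiderivative:
  fixes p :: "'a :: field_char_0 poly"
  shows "\<exists>q. pderiv q = p \<and> degree q \<le> Suc (degree p)"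
proof (intro exI conjI)
  let ?q = "\<Sum>i\<le>degree p. monom (coeff p i / of_nat (Suc i)) (Suc i)"
  show "pderiv ?q = p"
    by (rule poly_eqI)
       (auto simp: coeff_pderiv coeff_sum coeff_eq_0 if_distrib[of "\<lambda>x. _ * x"] simp del: of_nat_Suc cong: if_cong)
  show "degree ?q \<le> Suc (degree p)"
    by (intro degree_sum_le) (auto intro: order.trans[OF degree_monom_le])
qed

text \<open>The value is tuned to two consequences: \<open>exp 1 ^ 2 \<ge> 7\<close> and
  \<open>19 / 100 * (2 * exp 1 + 1) \<ge> 119 / 100\<close>.\<close>

lemma exp_one_ge: "exp (1::real) \<ge> 133 / 50"
proof -
  have "(1::real) + 1/4 + (1/4)^2 / 2 \<le> exp (1/4)" by (rule exp_lower_Taylor_quadratic) simp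
  then have "(1 + 1/4 + (1/4)^2 / 2) ^ 4 \<le> exp (1/4::real) ^ 4" by (rule power_mono) simp
  also have "\<dots> = exp 1" by (simp flip: exp_of_nat_mult)
  finally show ?thesis by (simp add: power_divide eval_nat_numeral)
qed

text \<open>This integrates the bound on the derivative without integrals:
  \<open>q + c / (t + s)\<close> has nonpositive derivative on either side of the pole at
  \<open>- s\<close>.\<close>

lemma poly_tail_bound:
  fixes q :: "real poly"
  assumes "a \<le> b" "0 \<notin> {a + s..b + s}"
    and le: "\<And>t. a \<le> t \<Longrightarrow> t \<le> b \<Longrightarrow> poly (pderiv q) t \<le> c / (t + s) ^ 2"
  shows "poly q b - poly q a \<le> c / (a + s) - c / (b + s)"
proof -
  have "poly q b + c / (b + s) \<le> poly q a + c / (a + s)"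
  proof (rule DERIV_nonpos_imp_nonincreasing[OF assms(1)])
    fix t assume t: "a \<le> t" "t \<le> b"
    then have "t + s \<noteq> 0" using assms(2) by auto
    then have "((\<lambda>t. poly q t + c / (t + s)) has_real_derivative
        poly (pderiv q) t - c / (t + s) ^ 2) (at t)"
      by (auto intro!: derivative_eq_intros simp: power2_eq_square)
    then show "\<exists>y. ((\<lambda>t. poly q t + c / (t + s)) has_real_derivative y) (at t) \<and> y \<le> 0"
      using le[OF t] by auto
  qed
  then show ?thesis by simp
qed

text \<open>The kernel is the Fejer polynomial at \<open>1 + 8/9 (\<delta>\<^sup>2/9 - u\<^sup>2)\<close> with \<open>u = t + \<delta>/2\<close>: this
  argument stays in \<open>[-1, 1]\<close> for \<open>\<delta>/3 \<le> \<bar>u\<bar> \<le> 3/2\<close> and exceeds \<open>1\<close> in the middle of the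
  transition zone \<open>[-\<delta>, 0]\<close>.\<close>
lemma step_poly_kernel:
  fixes \<delta> :: real and k :: nat
  assumes \<delta>: "0 < \<delta>" "\<delta> \<le> 1" and k: "k \<ge> 1"
  defines "T \<equiv> (1 + 19 / 100 * \<delta>) ^ (2 * k) / 2"
  shows "\<exists>p. degree p \<le> 2 * k - 2 \<and> (\<forall>t\<in>{-1..1}. 0 \<le> poly p t) \<and>
    (\<forall>t\<in>{-1..1}. \<bar>t + \<delta> / 2\<bar> \<ge> \<delta> / 2 \<longrightarrow> poly p t \<le> (81 / 20) / (t + \<delta> / 2) ^ 2) \<and>
    (\<forall>t. \<bar>t + \<delta> / 2\<bar> \<le> \<delta> / 6 \<longrightarrow> (81 / 8) * (T - 1) / \<delta> ^ 2 \<le> poly p t)"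
proof -
  define w where "w = [:1 + 8 / 9 * (\<delta> ^ 2 / 9 - \<delta> ^ 2 / 4), - 8 / 9 * \<delta>, - 8 / 9:]"
  have w: "poly w t = 1 + 8 / 81 * \<delta> ^ 2 - 8 / 9 * (t + \<delta> / 2) ^ 2" for t
    by (simp add: w_def power2_eq_square algebra_simps)
  define p where "p = pcompose (fejer_poly k) w"
  have p: "poly p t = poly (fejer_poly k) (poly w t)" for t
    by (simp add: p_def poly_pcompose)
  have "degree p \<le> (k - 1) * 2"
    using degree_fejer_poly[of k] by (auto simp: p_def w_def intro!: order.trans[OF degree_pcompose_le])
  then have deg: "degree p \<le> 2 * k - 2" by simp
  have w_ge: "- 1 \<le> poly w t" if "t \<in> {-1..1}" for t
  proof -
    define u where "u = (t + \<delta> / 2) ^ 2"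
    \<comment> \<open>This explains the scale 8/9 in \<open>w\<close>: at distance 3/2 from the
      centre, \<open>8 / 9 * (9 / 4) = 2\<close> lowers the argument from 1 to -1.\<close>
    have "\<bar>t + \<delta> / 2\<bar> \<le> 3 / 2" unfolding abs_le_iff using that \<delta> by simp
    then have "u \<le> (3 / 2) ^ 2" unfolding u_def by (metis abs_le_square_iff abs_numeral abs_divide)
    then have "u \<le> 9 / 4" by (simp add: power2_eq_square)
    moreover have "0 \<le> \<delta> ^ 2" by simp
    ultimately show ?thesis unfolding w u_def by linarith
  qed
  have tail: "poly p t \<le> (81 / 20) / (t + \<delta> / 2) ^ 2"
    if t: "t \<in> {-1..1}" and u: "\<bar>t + \<delta> / 2\<bar> \<ge> \<delta> / 2" for t
  proof -
    define u where "u = (t + \<delta> / 2) ^ 2"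
    have u: "\<delta> ^ 2 / 4 \<le> u"
      using power_mono[OF u, of 2] \<delta> by (simp add: u_def power_divide)
    have \<delta>2: "0 < \<delta> ^ 2" using \<delta> by simp
    have u0: "0 < u" using u \<delta>2 by linarith
    have "poly w t \<le> 1" using u \<delta>2 unfolding w u_def by linarith
    then have "(1 - poly w t) * poly p t \<le> 2"
      using fejer_poly_ge(1)[of "poly w t" k] w_ge[OF t] by (simp add: p abs_le_iff)
    \<comment> \<open>Here \<open>\<delta> ^ 2 \<le> 4 * u\<close>, and
      \<open>8 / 9 - 32 / 81 = 40 / 81\<close>; dividing 2 by this gives the constant 81/20.\<close>
    moreover have "40 / 81 * u \<le> 1 - poly w t"
      using u unfolding w u_def by linarith
    moreover have "0 \<le> poly p t" using fejer_poly_nonneg[OF w_ge[OF t]] by (simp add: p)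
    ultimately have "40 / 81 * u * poly p t \<le> 2"
      by (meson mult_right_mono order.trans)
    then have "poly p t \<le> (81 / 20) / u" using u0 by (simp add: field_simps)
    then show ?thesis by (simp add: u_def)
  qed
  have peak: "(81 / 8) * (T - 1) / \<delta> ^ 2 \<le> poly p t" if t: "\<bar>t + \<delta> / 2\<bar> \<le> \<delta> / 6" for t
  proof -
    define u where "u = (t + \<delta> / 2) ^ 2"
    have u: "u \<le> \<delta> ^ 2 / 36" "0 \<le> u"
      using power_mono[OF t, of 2] \<delta> by (simp_all add: u_def power_divide)
    have \<delta>2: "0 < \<delta> ^ 2" using \<delta> by simp
    \<comment> \<open>In the middle third \<open>w\<close> is at least
      \<open>1 + 2 / 27 * \<delta> ^ 2\<close>, and 19/100 lies just below the square root of 1/27.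
      The upper bound on \<open>w - 1\<close> produces the factor 81/8.\<close>
    have w12: "1 + 2 * (19 / 100 * \<delta>) ^ 2 \<le> poly w t" "poly w t - 1 \<le> 8 / 81 * \<delta> ^ 2"
      "1 \<le> poly w t"
    proof -
      have c: "(19 / 100 * \<delta>) ^ 2 = 361 / 10000 * \<delta> ^ 2"
        by (simp add: power_mult_distrib power_divide)
      show "1 + 2 * (19 / 100 * \<delta>) ^ 2 \<le> poly w t" "poly w t - 1 \<le> 8 / 81 * \<delta> ^ 2"
        "1 \<le> poly w t"
        using u \<delta>2 unfolding w u_def[symmetric] c by linarith+
    qed
    have p0: "0 \<le> poly p t" using fejer_poly_nonneg[of "poly w t"] w12 by (simp add: p)
    have "T \<le> 1 + (poly w t - 1) * poly p t"
      using fejer_poly_growth[OF _ w12(1), of k] \<delta> by (simp add: T_def p)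
    also have "(poly w t - 1) * poly p t \<le> 8 / 81 * \<delta> ^ 2 * poly p t"
      using w12 p0 by (intro mult_right_mono) auto
    finally have "(81 / 8) * (T - 1) \<le> poly p t * \<delta> ^ 2" by (simp add: mult.commute)
    then show ?thesis using \<delta>2 by (simp only: pos_divide_le_eq)
  qed
  have "0 \<le> poly p t" if "t \<in> {-1..1}" for t
    unfolding p by (rule fejer_poly_nonneg[OF w_ge[OF that]])
  then show ?thesis
    by (intro exI[of _ p] conjI ballI allI impI deg tail peak)
qed

text \<open>The step polynomial is the normalised integral of the kernel from \<open>t\<close> to \<open>1\<close>, which makes it
  monotone, hence nonnegative, for free. If \<open>\<eta> \<ge> 1\<close> the zero polynomial will do; otherwise
  \<open>E = 8 e\<^sup>2 / \<eta>\<close> is so large that the numerical constants are irrelevant.\<close>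
lemma step_poly:
  fixes \<delta> :: real and v :: nat
  assumes \<delta>: "0 < \<delta>" "\<delta> \<le> 1" and v: "v \<ge> 1"
  defines "\<eta> \<equiv> 8 * exp 1 ^ 2 * exp (- 1 / (2 * exp 1 + 1)) powr (\<delta> * real v)"
  shows "\<exists>h. degree h \<le> v \<and> (\<forall>t\<in>{-1..1}. 0 \<le> poly h t \<and> poly h t \<le> 1) \<and>
    (\<forall>t\<in>{0..1}. poly h t \<le> \<eta>) \<and> (\<forall>t\<in>{-1..-\<delta>}. 1 - \<eta> \<le> poly h t)"
proof (cases "\<eta> \<ge> 1")
  case True
  then show ?thesis by (intro exI[of _ 0]) auto
next
  case False
  define E where "E = exp (\<delta> * real v / (2 * exp 1 + 1))"
  have E: "E > 0" by (simp add: E_def)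
  have "exp (- 1 / (2 * exp 1 + 1)) powr (\<delta> * real v) = exp (- (\<delta> * real v / (2 * exp 1 + 1)))"
    by (simp only: powr_def ln_exp exp_not_eq_zero if_False) simp
  then have \<eta>: "\<eta> = 8 * exp 1 ^ 2 / E"
    by (simp add: \<eta>_def E_def exp_minus divide_inverse)
  have e: "133 / 50 \<le> exp (1::real)" by (rule exp_one_ge)
  have e2: "7 \<le> exp (1::real) ^ 2"
    using power_mono[OF e, of 2] by (simp add: power_divide)
  have \<eta>0: "0 < \<eta>" "\<eta> < 1" using False E by (auto simp: \<eta>)
  \<comment> \<open>The composed kernel has degree at most \<open>2 * k - 2\<close>, so its integral
    has degree at most \<open>2 * k - 1 \<le> v\<close>, while the growth exponent
    \<open>2 * k\<close> still reaches v.\<close>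
  define k where "k = (v + 1) div 2"
  have k: "k \<ge> 1" "2 * k - 1 \<le> v" "v \<le> 2 * k" using v by (auto simp: k_def)
  define T where "T = (1 + 19 / 100 * \<delta>) ^ (2 * k) / 2"
  have "T \<ge> E / 2"
  proof -
    \<comment> \<open>The rate \<open>1 / (2 * exp 1 + 1)\<close> enters here, through
      \<open>ln (1 + z) \<ge> z / (1 + z)\<close> at \<open>z = 19 / 100 * \<delta>\<close>.\<close>
    have "\<delta> / (2 * exp 1 + 1) \<le> (19 / 100 * \<delta>) / (1 + 19 / 100 * \<delta>)"
    proof -
      have "1 + 19 / 100 * \<delta> \<le> 119 / 100" using \<delta> by simp
      also have "\<dots> \<le> 19 / 100 * (2 * exp 1 + 1)" using e by simp
      finally have "\<delta> * (1 + 19 / 100 * \<delta>) \<le> \<delta> * (19 / 100 * (2 * exp 1 + 1))"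
        using \<delta> by (intro mult_left_mono) auto
      then show ?thesis using \<delta> e by (simp add: field_simps add_pos_pos)
    qed
    also have "\<dots> \<le> ln (1 + 19 / 100 * \<delta>)"
      using ln_le_minus_one[of "1 / (1 + 19 / 100 * \<delta>)"] \<delta>
      by (simp add: ln_div field_simps add_pos_pos)
    finally have "exp (\<delta> / (2 * exp 1 + 1)) \<le> 1 + 19 / 100 * \<delta>"
      using \<delta> by (subst (asm) ln_ge_iff) auto
    then have "exp (\<delta> / (2 * exp 1 + 1)) ^ v \<le> (1 + 19 / 100 * \<delta>) ^ v"
      by (intro power_mono) auto
    also have "\<dots> \<le> (1 + 19 / 100 * \<delta>) ^ (2 * k)"
      using \<delta> k by (intro power_increasing) auto
    also have "exp (\<delta> / (2 * exp 1 + 1)) ^ v = E"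
      by (simp add: E_def mult.commute flip: exp_of_nat_mult)
    finally show ?thesis by (simp add: T_def)
  qed
  \<comment> \<open>The threshold 12/5 is what makes \<open>\<eta>\<close> times the central mass
    \<open>27 / 8 * (T - 1) / \<delta>\<close> cover a tail of mass
    \<open>81 / 10 / \<delta>\<close>.\<close>
  then have "12 / 5 \<le> \<eta> * (T - 1)"
  proof -
    assume "E / 2 \<le> T"
    then have "\<eta> * (E / 2) \<le> \<eta> * T" using \<eta>0 by (intro mult_left_mono) auto
    moreover have "\<eta> * (E / 2) = 4 * exp 1 ^ 2" using E by (simp add: \<eta>)
    moreover have "\<eta> * (T - 1) = \<eta> * T - \<eta>" by (simp add: algebra_simps)
    ultimately show ?thesis using e2 \<eta>0 by linarith
  qed
  then have T1: "12 / 5 \<le> \<eta> * (T - 1)" "T > 1"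
    using \<eta>0 mult_nonneg_nonpos[of \<eta> "T - 1"] by linarith+
  obtain p where p: "degree p \<le> 2 * k - 2" "\<And>t. t \<in> {-1..1} \<Longrightarrow> 0 \<le> poly p t"
    "\<And>t. t \<in> {-1..1} \<Longrightarrow> \<bar>t + \<delta> / 2\<bar> \<ge> \<delta> / 2 \<Longrightarrow> poly p t \<le> (81 / 20) / (t + \<delta> / 2) ^ 2"
    "\<And>t. \<bar>t + \<delta> / 2\<bar> \<le> \<delta> / 6 \<Longrightarrow> (81 / 8) * (T - 1) / \<delta> ^ 2 \<le> poly p t"
    using step_poly_kernel[OF \<delta> k(1)] unfolding T_def by blast
  obtain q where q: "pderiv q = p" "degree q \<le> Suc (degree p)"
    using ex_poly_antiderivative by blast
  have mono: "poly q a \<le> poly q b" if "-1 \<le> a" "a \<le> b" "b \<le> 1" for a b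
    using that(2) by (rule DERIV_nonneg_imp_nondecreasing)
      (use that p(2) q(1) in \<open>auto intro!: exI[of _ "poly p _"] DERIV_cong[OF poly_DERIV]\<close>)
  define Z where "Z = poly q 1 - poly q (-1)"
  \<comment> \<open>Only the middle third of the transition zone is counted: its length
    \<open>\<delta> / 3\<close> times the peak bound, by the mean value theorem.\<close>
  have Z: "(27 / 8) * (T - 1) / \<delta> \<le> Z"
  proof -
    let ?a = "- (2 / 3) * \<delta>" and ?b = "- \<delta> / 3"
    let ?c = "(81 / 8) * (T - 1) / \<delta> ^ 2"
    have ab: "?a < ?b" using \<delta> by simp
    from poly_MVT[OF ab, of q] obtain x where x: "?a < x" "x < ?b"
      "poly q ?b - poly q ?a = (?b - ?a) * poly p x"
      using q(1) by auto
    have "\<bar>x + \<delta> / 2\<bar> \<le> \<delta> / 6" unfolding abs_le_iff using x(1,2) by simp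
    from p(4)[OF this] have "(?b - ?a) * ?c \<le> (?b - ?a) * poly p x"
      using ab by (intro mult_left_mono) auto
    moreover have "(?b - ?a) * ?c = (27 / 8) * (T - 1) / \<delta>"
      using \<delta> by (simp add: field_simps power2_eq_square)
    moreover have "poly q ?b \<le> poly q 1" "poly q (-1) \<le> poly q ?a"
      using \<delta> by (auto intro!: mono)
    ultimately show ?thesis using x(3) by (simp add: Z_def)
  qed
  have "81 / 10 / \<delta> \<le> \<eta> * ((27 / 8) * (T - 1) / \<delta>)"
    using T1(1) \<delta> by (simp add: field_simps)
  also have "\<dots> \<le> \<eta> * Z" using Z \<eta>0 by (intro mult_left_mono) auto
  finally have Z\<eta>: "81 / 10 / \<delta> \<le> \<eta> * Z" .
  have "0 < (27 / 8) * (T - 1) / \<delta>" using T1(2) \<delta> by simp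
  then have Z0: "Z > 0" using Z by linarith
  \<comment> \<open>The endpoint nearer the centre is at distance at least
    \<open>\<delta> / 2\<close> and contributes at most \<open>81 / 10 / \<delta>\<close>; the term
    of the other endpoint has the favourable sign.\<close>
  have tail: "poly q b - poly q a \<le> \<eta> * Z"
    if "- 1 \<le> a" "a \<le> b" "b \<le> 1" "0 \<le> a \<or> b \<le> - \<delta>" for a b
  proof -
    have "poly q b - poly q a \<le> (81 / 20) / (a + \<delta> / 2) - (81 / 20) / (b + \<delta> / 2)"
      by (rule poly_tail_bound) (use that \<delta> p(3) q(1) in auto)
    also have "\<dots> \<le> (81 / 20) / (\<delta> / 2)"
    proof (cases "0 \<le> a")
      case True
      then have "(81 / 20) / (a + \<delta> / 2) \<le> (81 / 20) / (\<delta> / 2)"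
        using \<delta> by (intro divide_left_mono) auto
      moreover have "0 \<le> (81 / 20) / (b + \<delta> / 2)" using True that \<delta> by auto
      ultimately have "(81 / 20) / (a + \<delta> / 2) - (81 / 20) / (b + \<delta> / 2) \<le> (81 / 20) / (\<delta> / 2) - 0"
        by (rule diff_mono)
      then show ?thesis by (simp only: diff_zero)
    next
      case False
      then have b: "b \<le> - \<delta>" using that by auto
      then have "(81 / 20) / (- (b + \<delta> / 2)) \<le> (81 / 20) / (\<delta> / 2)"
        using \<delta> by (intro divide_left_mono) auto
      then have "- ((81 / 20) / (\<delta> / 2)) \<le> (81 / 20) / (b + \<delta> / 2)"
        unfolding divide_minus_right by (rule minus_le_iff[THEN iffD1])
      moreover have "(81 / 20) / (a + \<delta> / 2) \<le> 0"
        using b that \<delta> by (intro divide_nonneg_nonpos) auto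
      ultimately have "(81 / 20) / (a + \<delta> / 2) - (81 / 20) / (b + \<delta> / 2) \<le> 0 - (- ((81 / 20) / (\<delta> / 2)))"
        by (intro diff_mono)
      then show ?thesis by (simp only: diff_0 minus_minus)
    qed
    also have "\<dots> = 81 / 10 / \<delta>" by simp
    also note Z\<eta>
    finally show ?thesis .
  qed
  define h where "h = smult (1 / Z) ([:poly q 1:] - q)"
  have h: "poly h t = (poly q 1 - poly q t) / Z" for t by (simp add: h_def)
  have "degree h \<le> v"
  proof -
    have "degree h \<le> degree ([:poly q 1:] - q)" unfolding h_def by (rule degree_smult_le)
    also have "\<dots> \<le> degree q" by (intro degree_diff_le) auto
    also have "\<dots> \<le> v" using q(2) p(1) k by linarith
    finally show ?thesis .
  qed
  moreover have "0 \<le> poly h t \<and> poly h t \<le> 1" if "t \<in> {-1..1}" for t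
    using mono[of t 1] mono[of "-1" t] that Z0 by (auto simp: h Z_def)
  moreover have "poly h t \<le> \<eta>" if "t \<in> {0..1}" for t
    using tail[of t 1] that Z0 by (auto simp: h field_simps)
  moreover have "1 - \<eta> \<le> poly h t" if "t \<in> {-1..-\<delta>}" for t
    using tail[of "-1" t] that Z0 \<delta> by (auto simp: h field_simps Z_def)
  ultimately show ?thesis by blast
qed

section \<open>Evaluation and degree of polynomials in several variables\<close>

definition monom_eval :: "('n::finite \<Rightarrow>\<^sub>0 nat) \<Rightarrow> real^'n \<Rightarrow> real" where
  "monom_eval \<alpha> x = (\<Prod>i\<in>UNIV. (x $ i) ^ Poly_Mapping.lookup \<alpha> i)"

text \<open>Added terms have coefficient zero, so polynomials with different supports can share one
  index set.\<close>

lemma meval_superset: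
  assumes "finite K" "Poly_Mapping.keys p \<subseteq> K"
  shows "meval p x = (\<Sum>\<alpha>\<in>K. Poly_Mapping.lookup p \<alpha> * monom_eval \<alpha> x)"
  unfolding meval_def monom_eval_def
  by (rule sum.mono_neutral_left) (use assms in \<open>auto simp: in_keys_iff\<close>)

lemma meval_add [simp]: "meval (p + q) x = meval p x + meval q x"
proof -
  let ?K = "Poly_Mapping.keys p \<union> Poly_Mapping.keys q"
  have "meval r x = (\<Sum>\<alpha>\<in>?K. Poly_Mapping.lookup r \<alpha> * monom_eval \<alpha> x)"
    if "r \<in> {p, q, p + q}" for r
    using that by (intro meval_superset) (auto dest: subsetD[OF keys_add])
  then show ?thesis by (simp add: lookup_add distrib_right sum.distrib)
qed

lemma meval_0 [simp]: "meval 0 x = 0" by (simp add: meval_def)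

lemma meval_diff [simp]: "meval (p - q) x = meval p x - meval q x"
  using meval_add[of "p - q" q x] by simp

lemma meval_sum [simp]: "meval (sum p A) x = (\<Sum>a\<in>A. meval (p a) x)"
  by (induction A rule: infinite_finite_induct) auto

lemma meval_single: "meval (Poly_Mapping.single \<alpha> c) x = c * monom_eval \<alpha> x"
  by (simp add: meval_superset[of "{\<alpha>}"] )

lemma meval_mconst [simp]: "meval (mconst c) x = c"
  by (simp add: mconst_def meval_single monom_eval_def)

lemma meval_1 [simp]: "meval 1 x = 1"
  using meval_mconst[of 1 x] by (simp add: mconst_def)

lemma monom_eval_add: "monom_eval (\<alpha> + \<beta>) x = monom_eval \<alpha> x * monom_eval \<beta> x"
  by (simp add: monom_eval_def lookup_add power_add prod.distrib)

lemma poly_mapping_sum_single: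
  "p = (\<Sum>\<alpha>\<in>Poly_Mapping.keys p. Poly_Mapping.single \<alpha> (Poly_Mapping.lookup p \<alpha>))"
  by (rule poly_mapping_eqI) (auto simp: lookup_sum lookup_single when_def in_keys_iff)

lemma meval_mult [simp]: "meval (p * q) x = meval p x * meval q x"
proof -
  have "p * q = (\<Sum>\<alpha>\<in>Poly_Mapping.keys p. \<Sum>\<beta>\<in>Poly_Mapping.keys q.
      Poly_Mapping.single (\<alpha> + \<beta>) (Poly_Mapping.lookup p \<alpha> * Poly_Mapping.lookup q \<beta>))"
    by (subst poly_mapping_sum_single[of p], subst poly_mapping_sum_single[of q])
       (simp add: sum_product mult_single)
  also have "meval \<dots> x = (\<Sum>\<alpha>\<in>Poly_Mapping.keys p. Poly_Mapping.lookup p \<alpha> * monom_eval \<alpha> x) *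
      (\<Sum>\<beta>\<in>Poly_Mapping.keys q. Poly_Mapping.lookup q \<beta> * monom_eval \<beta> x)"
    by (simp add: meval_single monom_eval_add sum_product mult_ac)
  finally show ?thesis by (simp add: meval_superset[OF finite_keys order.refl])
qed

lemma meval_power [simp]: "meval (p ^ k) x = meval p x ^ k"
  by (induction k) auto

lemma meval_mvar [simp]: "meval (mvar i) x = x $ i"
  by (simp add: mvar_def meval_single monom_eval_def lookup_single when_def
      if_distrib[of "\<lambda>k. _ ^ k"] cong: if_cong)

lemma continuous_on_meval: "continuous_on S (meval p)"
  unfolding meval_def by (intro continuous_intros)

lemma mdeg_le_iff:
  "mdeg p \<le> k \<longleftrightarrow> (\<forall>\<alpha>\<in>Poly_Mapping.keys p. (\<Sum>i\<in>UNIV. Poly_Mapping.lookup \<alpha> i) \<le> k)"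
  by (auto simp: mdeg_def)

lemma mdeg_0 [simp]: "mdeg 0 = 0" by (simp add: mdeg_def)

lemma mdeg_mconst [simp]: "mdeg (mconst c) = 0"
  by (simp add: mdeg_def mconst_def)

lemma mdeg_1 [simp]: "mdeg 1 = 0"
  by (simp add: mdeg_def)

lemma mdeg_mvar: "mdeg (mvar i) \<le> 1"
  by (auto simp: mdeg_le_iff mvar_def lookup_single when_def)

lemma mdeg_add_le: "mdeg p \<le> k \<Longrightarrow> mdeg q \<le> k \<Longrightarrow> mdeg (p + q) \<le> k"
  using keys_add[of p q] by (auto simp: mdeg_le_iff)

lemma mdeg_diff_le: "mdeg p \<le> k \<Longrightarrow> mdeg q \<le> k \<Longrightarrow> mdeg (p - q) \<le> k"
  using keys_diff[of p q] by (auto simp: mdeg_le_iff)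

lemma mdeg_sum_le: "(\<And>a. a \<in> A \<Longrightarrow> mdeg (p a) \<le> k) \<Longrightarrow> mdeg (sum p A) \<le> k"
  by (induction A rule: infinite_finite_induct) (auto intro: mdeg_add_le)

lemma mdeg_mult_le: "mdeg p \<le> j \<Longrightarrow> mdeg q \<le> k \<Longrightarrow> mdeg (p * q) \<le> j + k"
  using keys_mult[of p q] 
  by (fastforce simp: mdeg_le_iff lookup_add sum.distrib intro: add_mono)

section \<open>Extrema and Lipschitz bounds on the ball\<close>

lemma meval_le_ball_norm:
  assumes "x \<in> unit_ball"
  shows "\<bar>meval p x\<bar> \<le> ball_norm p"
proof -
  have "compact ((\<lambda>x. \<bar>meval p x\<bar>) ` unit_ball)"
    by (intro compact_continuous_image continuous_intros continuous_on_meval) auto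
  then show ?thesis unfolding ball_norm_def
    using assms by (intro cSUP_upper) (auto intro: compact_imp_bounded bounded_imp_bdd_above)
qed

lemma min_on_le:
  assumes "x \<in> S" "S \<subseteq> unit_ball"
  shows "min_on S p \<le> meval p x"
proof -
  have "- ball_norm p \<le> meval p y" if "y \<in> S" for y
    using meval_le_ball_norm[of y p] that assms(2) by auto
  then show ?thesis unfolding min_on_def using assms(1)
    by (intro cINF_lower bdd_belowI[of _ "- ball_norm p"]) auto
qed

lemma le_max_on:
  assumes "x \<in> S" "S \<subseteq> unit_ball"
  shows "meval p x \<le> max_on S p"
proof -
  have "meval p y \<le> ball_norm p" if "y \<in> S" for y
    using meval_le_ball_norm[of y p] that assms(2) by auto
  then show ?thesis unfolding max_on_def using assms(1)
    by (intro cSUP_upper bdd_aboveI[of _ "ball_norm p"]) auto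
qed

text \<open>The Lipschitz estimate holds against every point of \<open>X\<close>; dividing by L
  turns it into a lower bound for the infimum of the distances, so \<open>L = 0\<close> is treated
  apart.\<close>

lemma lipschitz_infdist_lower:
  assumes lip: "L-lipschitz_on S f" and "x \<in> S" "X \<subseteq> S" "X \<noteq> {}"
    and c: "\<And>y. y \<in> X \<Longrightarrow> c \<le> f y"
  shows "c - L * infdist x X \<le> f x"
proof (cases "L = 0")
  case True
  obtain y where "y \<in> X" using assms(4) by blast
  then show ?thesis using c[of y] lipschitz_onD[OF lip, of x y] assms True by auto
next
  case False
  then have L: "L > 0" using lipschitz_on_nonneg[OF lip] by simp
  have "(c - f x) / L \<le> infdist x X"
    unfolding infdist_notempty[OF assms(4)]
  proof (rule cINF_greatest[OF assms(4)])
    fix y assume y: "y \<in> X"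
    then have "c - f x \<le> L * dist x y"
      using c[of y] lipschitz_onD[OF lip, of x y] assms(2,3) unfolding dist_real_def
      by (smt (verit) subsetD)
    then show "(c - f x) / L \<le> dist x y" using L by (simp add: field_simps)
  qed
  then show ?thesis using L by (simp add: field_simps)
qed

section \<open>Spectral decomposition of symmetric matrices\<close>

text \<open>A maximiser \<open>v\<close> of the quadratic form on the unit sphere of
  \<open>S\<close> is an eigenvector: moving from \<open>v\<close> along the residual
  \<open>w = f v - l v\<close> would otherwise increase the Rayleigh quotient.\<close>

lemma self_adjoint_eigenvector:
  fixes f :: "'a::euclidean_space \<Rightarrow> 'a"
  assumes "linear f" and adj: "\<And>x y. f x \<bullet> y = x \<bullet> f y"
    and S: "subspace S" "\<And>x. x \<in> S \<Longrightarrow> f x \<in> S" "S \<noteq> {0}"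
  shows "\<exists>v\<in>S. v \<bullet> v = 1 \<and> f v = (v \<bullet> f v) *\<^sub>R v"
proof -
  interpret linear f by fact
  obtain z where z: "z \<in> S" "z \<noteq> 0" using S(1,3) subspace_0 by blast
  have "z /\<^sub>R norm z \<in> sphere 0 1 \<inter> S" using z S(1) by (auto intro: subspace_scale)
  then have ne: "sphere 0 1 \<inter> S \<noteq> {}" by blast
  have cpt: "compact (sphere 0 1 \<inter> S)"
    by (intro compact_Int_closed closed_subspace S) auto
  have "continuous_on (sphere 0 1 \<inter> S) (\<lambda>x. x \<bullet> f x)"
    by (intro continuous_intros linear_continuous_on linear_conv_bounded_linear[THEN iffD1] assms)
  from continuous_attains_sup[OF cpt ne this]
  obtain v where v: "v \<in> S" "norm v = 1"
      and max: "\<And>u. u \<in> S \<Longrightarrow> norm u = 1 \<Longrightarrow> u \<bullet> f u \<le> v \<bullet> f v"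
    by auto
  define l where "l = v \<bullet> f v"
  have vv: "v \<bullet> v = 1" using v by (simp add: dot_square_norm)
  have max': "u \<bullet> f u \<le> l * (u \<bullet> u)" if "u \<in> S" for u
  proof (cases "u = 0")
    case False
    have "(u /\<^sub>R norm u) \<bullet> f (u /\<^sub>R norm u) \<le> l"
      unfolding l_def using that False S(1) by (intro max) (auto intro: subspace_scale)
    then show ?thesis using False by (simp add: scale field_simps dot_square_norm power2_eq_square)
  qed (simp add: zero)
  define w where "w = f v - l *\<^sub>R v"
  have w: "w \<in> S" unfolding w_def by (intro subspace_diff subspace_scale S v)
  define N where "N = w \<bullet> w"
  define c where "c = w \<bullet> f w - l * N"
  have N: "N = w \<bullet> f v - l * (w \<bullet> v)" by (simp add: N_def w_def inner_diff_right inner_diff_left)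
  \<comment> \<open>Maximality at \<open>v + t w\<close>: the linear coefficient is twice the
    squared norm \<open>N\<close> of the residual, since \<open>v\<close> and \<open>f\<close> pair
    symmetrically.\<close>
  have *: "2 * t * N + t ^ 2 * c \<le> 0" for t
  proof -
    have "(v + t *\<^sub>R w) \<bullet> f (v + t *\<^sub>R w) \<le> l * ((v + t *\<^sub>R w) \<bullet> (v + t *\<^sub>R w))"
      by (intro max' subspace_add subspace_scale S v w)
    moreover have "v \<bullet> f w = w \<bullet> f v" using adj[of v w] by (simp add: inner_commute)
    ultimately show ?thesis using vv
      by (simp add: add scale inner_add_left inner_add_right N c_def N_def[symmetric]
          l_def[symmetric] inner_commute[of v w] algebra_simps power2_eq_square)
  qed
  have "N = 0"
  proof (rule ccontr)
    assume "N \<noteq> 0"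
    then have N0: "N > 0" by (simp add: N_def)
    \<comment> \<open>So small that the quadratic term is at most \<open>N\<close> in absolute value
      after division by t, leaving \<open>2 * N + t * c \<ge> N > 0\<close>.\<close>
    define t where "t = N / (\<bar>c\<bar> + 1)"
    have t: "t > 0" using N0 by (simp add: t_def)
    have "t * (2 * N + t * c) \<le> 0" using *[of t] by (simp add: algebra_simps power2_eq_square)
    then have "2 * N + t * c \<le> 0" using t by (simp add: mult_le_0_iff)
    moreover have "t * \<bar>c\<bar> \<le> N" using N0 by (simp add: t_def field_simps)
    moreover have "- (t * c) \<le> t * \<bar>c\<bar>" using t abs_ge_minus_self[of "t * c"] by (simp add: abs_mult)
    ultimately show False using N0 by linarith
  qed
  then have "f v = l *\<^sub>R v" by (simp add: N_def w_def)
  then show ?thesis using v vv l_def by blast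
qed

text \<open>Take an orthonormal set of eigenvectors of greatest cardinality. Its orthogonal
  complement is invariant under \<open>f\<close>, so a nonzero complement would supply one more
  eigenvector.\<close>

lemma self_adjoint_eigenbasis:
  fixes f :: "'a::euclidean_space \<Rightarrow> 'a"
  assumes lin: "linear f" and adj: "\<And>x y. f x \<bullet> y = x \<bullet> f y"
  shows "\<exists>B. finite B \<and> card B \<le> DIM('a) \<and> (\<forall>b\<in>B. b \<bullet> b = 1 \<and> f b = (b \<bullet> f b) *\<^sub>R b) \<and>
    (\<forall>x. x = (\<Sum>b\<in>B. (x \<bullet> b) *\<^sub>R b))"
proof -
  define P where "P B \<longleftrightarrow> (\<forall>b\<in>B. \<forall>c\<in>B. b \<bullet> c = (if b = c then 1 else 0)) \<and>
    (\<forall>b\<in>B. f b = (b \<bullet> f b) *\<^sub>R b)" for B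
  have card: "finite B \<and> card B \<le> DIM('a)" if "P B" for B
  proof -
    have "b \<bullet> b = 1" if "b \<in> B" for b using \<open>P B\<close> that by (simp add: P_def)
    from this[of 0] have "0 \<notin> B" by auto
    moreover have "pairwise orthogonal B"
      using that by (auto simp: P_def pairwise_def orthogonal_def)
    ultimately show ?thesis by (intro independent_bound pairwise_orthogonal_independent)
  qed
  have "P {}" by (simp add: P_def)
  then obtain B where B: "P B" and max: "\<And>C. P C \<Longrightarrow> card C \<le> card B"
    using ex_has_greatest_nat[of P "{}" card "Suc DIM('a)"] card by (metis le_imp_less_Suc)
  have fin: "finite B" using card[OF B] by blast
  define S where "S = {x. \<forall>b\<in>B. x \<bullet> b = 0}"
  have "S = {0}"
  proof (rule ccontr)
    assume "S \<noteq> {0}"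
    moreover have "subspace S"
      by (auto simp: S_def subspace_def inner_add_left)
    moreover have "f x \<in> S" if "x \<in> S" for x
      unfolding S_def
    proof safe
      fix b assume b: "b \<in> B"
      then have "f b = (b \<bullet> f b) *\<^sub>R b" using B by (auto simp: P_def)
      then have "x \<bullet> f b = (b \<bullet> f b) * (x \<bullet> b)" by (metis inner_scaleR_right)
      then show "f x \<bullet> b = 0" using that b by (simp add: adj S_def)
    qed
    ultimately obtain v where v: "v \<in> S" "v \<bullet> v = 1" "f v = (v \<bullet> f v) *\<^sub>R v"
      using self_adjoint_eigenvector[OF lin adj] by blast
    have "v \<notin> B" using v by (auto simp: S_def)
    have "P (insert v B)"
      using B v \<open>v \<notin> B\<close> unfolding P_def by (auto simp: S_def inner_commute)
    from max[OF this] show False using \<open>v \<notin> B\<close> fin by simp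
  qed
  have "x = (\<Sum>b\<in>B. (x \<bullet> b) *\<^sub>R b)" for x
  proof -
    have "(x - (\<Sum>b\<in>B. (x \<bullet> b) *\<^sub>R b)) \<bullet> c = 0" if "c \<in> B" for c
    proof -
      have "(\<Sum>b\<in>B. (x \<bullet> b) *\<^sub>R b) \<bullet> c = (\<Sum>b\<in>B. if b = c then x \<bullet> b else 0)"
        unfolding inner_sum_left using B that by (intro sum.cong) (auto simp: P_def)
      then show ?thesis using that fin by (simp add: inner_diff_left)
    qed
    then have "x - (\<Sum>b\<in>B. (x \<bullet> b) *\<^sub>R b) \<in> S" by (simp add: S_def)
    then show ?thesis using \<open>S = {0}\<close> by simp
  qed
  then show ?thesis using card[OF B] B by (intro exI[of _ B]) (auto simp: P_def)
qed

definition rayleigh :: "real^'m^'m \<Rightarrow> real^'m \<Rightarrow> real" where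
  "rayleigh A b = b \<bullet> (A *v b)"

text \<open>Pairwise orthogonality is implicit: expanding \<open>b\<close> itself and pairing with
  \<open>b\<close> gives 1 plus the squares of the other inner products. The eigenvalue of
  \<open>b\<close> is its Rayleigh quotient.\<close>

definition eigenbasis :: "real^'m^'m \<Rightarrow> (real^'m) set \<Rightarrow> bool" where
  "eigenbasis A B \<longleftrightarrow> finite B \<and> card B \<le> CARD('m) \<and>
     (\<forall>b\<in>B. b \<bullet> b = 1 \<and> A *v b = rayleigh A b *\<^sub>R b) \<and> (\<forall>x. x = (\<Sum>b\<in>B. (x \<bullet> b) *\<^sub>R b))"

lemma eigenbasisD:
  fixes A :: "real^'m^'m"
  assumes "eigenbasis A B"
  shows "finite B" "card B \<le> CARD('m)" "b \<in> B \<Longrightarrow> b \<bullet> b = 1"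
    "b \<in> B \<Longrightarrow> A *v b = rayleigh A b *\<^sub>R b" "x = (\<Sum>b\<in>B. (x \<bullet> b) *\<^sub>R b)"
  using assms by (auto simp: eigenbasis_def)

lemma symmetric_matrix_inner:
  fixes A :: "real^'m^'m"
  assumes "transpose A = A"
  shows "(A *v x) \<bullet> y = x \<bullet> (A *v y)"
  using dot_lmul_matrix[of x A y] transpose_matrix_vector[of A x] assms by simp

lemma ex_eigenbasis:
  fixes A :: "real^'m^'m"
  assumes "transpose A = A"
  obtains B where "eigenbasis A B"
  using self_adjoint_eigenbasis[of "(*v) A"] symmetric_matrix_inner[OF assms]
  by (auto simp: eigenbasis_def rayleigh_def)

lemma eigenbasis_nonempty:
  assumes "eigenbasis A B"
  shows "B \<noteq> {}"
proof
  assume "B = {}"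
  then have "axis undefined 1 = (0 :: real^'m)"
    using eigenbasisD(5)[OF assms, of "axis undefined 1"] by simp
  then show False by (simp add: axis_eq_0_iff)
qed

text \<open>The completeness relation: the projections onto the basis vectors sum to the identity
  matrix.\<close>

lemma eigenbasis_delta:
  assumes "eigenbasis A B"
  shows "(\<Sum>b\<in>B. b $ i * b $ j) = (if i = j then 1 else 0)"
proof -
  have "(if i = j then 1 else 0) = axis i (1::real) $ j" by (simp add: axis_def)
  also have "\<dots> = (\<Sum>b\<in>B. (axis i 1 \<bullet> b) *\<^sub>R b) $ j"
    using eigenbasisD(5)[OF assms, of "axis i 1"] by simp
  finally show ?thesis by (simp add: inner_axis')
qed

lemma eigenbasis_trace:
  assumes "eigenbasis A B"
  shows "trace M = (\<Sum>b\<in>B. b \<bullet> (M *v b))"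
proof -
  have "(\<Sum>b\<in>B. b \<bullet> (M *v b)) = (\<Sum>b\<in>B. \<Sum>i\<in>UNIV. \<Sum>j\<in>UNIV. M $ i $ j * (b $ i * b $ j))"
    by (simp add: inner_vec_def matrix_vector_mult_def sum_distrib_left mult_ac)
  also have "\<dots> = (\<Sum>i\<in>UNIV. \<Sum>j\<in>UNIV. \<Sum>b\<in>B. M $ i $ j * (b $ i * b $ j))"
    by (subst sum.swap, intro sum.cong refl, subst sum.swap, rule refl)
  also have "\<dots> = (\<Sum>i\<in>UNIV. \<Sum>j\<in>UNIV. if i = j then M $ i $ j else 0)"
    by (simp add: eigenbasis_delta[OF assms] mult_delta_right flip: sum_distrib_left)
  also have "\<dots> = trace M" by (simp add: trace_def)
  finally show ?thesis by simp
qed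

text \<open>\<open>spectral_radius\<close> ranges over complex eigenvalues, so these must be shown
  to be the real ones. A complex eigenvector has a nonzero coordinate \<open>p b\<close> along some
  real basis vector, and pairing the eigenvalue equation with that \<open>b\<close> identifies
  \<open>c\<close>.\<close>

lemma eigenvalue_complex_iff:
  fixes A :: "real^'m^'m"
  assumes sym: "transpose A = A" and B: "eigenbasis A B"
  shows "eigenvalue (map_matrix complex_of_real A) c \<longleftrightarrow> c \<in> complex_of_real ` rayleigh A ` B"
proof
  let ?A = "map_matrix complex_of_real A"
  assume "eigenvalue ?A c"
  then obtain v where v: "v \<noteq> 0" "?A *v v = c *s v" by (auto simp: eigenvalue_def)
  define p where "p b = (\<Sum>i\<in>UNIV. complex_of_real (b $ i) * v $ i)" for b :: "real^'m"
  have "v $ i = (\<Sum>b\<in>B. complex_of_real (b $ i) * p b)" for i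
  proof -
    have "(\<Sum>b\<in>B. complex_of_real (b $ i) * p b) =
        (\<Sum>j\<in>UNIV. complex_of_real (\<Sum>b\<in>B. b $ i * b $ j) * v $ j)"
      unfolding p_def sum_distrib_left by (subst sum.swap)
        (simp add: sum_distrib_right sum_distrib_left mult_ac)
    also have "\<dots> = (\<Sum>j\<in>UNIV. if i = j then v $ j else 0)"
      by (intro sum.cong) (auto simp: eigenbasis_delta[OF B] simp del: of_real_sum)
    finally show ?thesis by simp
  qed
  moreover obtain i where "v $ i \<noteq> 0" using v by (auto simp: vec_eq_iff)
  ultimately obtain b where b: "b \<in> B" "p b \<noteq> 0" by (metis (no_types, lifting) mult_zero_right sum.neutral)
  have "c * p b = (\<Sum>i\<in>UNIV. complex_of_real (b $ i) * (?A *v v) $ i)"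
    unfolding v(2) p_def by (simp add: sum_distrib_left mult_ac)
  also have "\<dots> = (\<Sum>j\<in>UNIV. complex_of_real (\<Sum>i\<in>UNIV. A $ i $ j * b $ i) * v $ j)"
    unfolding matrix_vector_mult_def
    by (simp add: sum_distrib_left sum_distrib_right mult_ac) (rule sum.swap)
  also have "\<dots> = (\<Sum>j\<in>UNIV. complex_of_real ((A *v b) $ j) * v $ j)"
  proof -
    have "(\<Sum>i\<in>UNIV. A $ i $ j * b $ i) = (transpose A *v b) $ j" for j
      unfolding transpose_def matrix_vector_mult_def by simp
    then show ?thesis unfolding sym by (simp only:)
  qed
  also have "\<dots> = complex_of_real (rayleigh A b) * p b"
    by (subst eigenbasisD(4)[OF B b(1)]) (simp add: p_def sum_distrib_left mult_ac)
  finally show "c \<in> complex_of_real ` rayleigh A ` B" using b by auto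
next
  let ?A = "map_matrix complex_of_real A"
  assume "c \<in> complex_of_real ` rayleigh A ` B"
  then obtain b where b: "b \<in> B" "c = complex_of_real (rayleigh A b)" by auto
  let ?v = "\<chi> i. complex_of_real (b $ i)"
  have "b \<noteq> 0" using eigenbasisD(3)[OF B b(1)] by auto
  then have "?v \<noteq> 0" by (auto simp: vec_eq_iff)
  moreover have "?A *v ?v = c *s ?v"
  proof -
    have "(A *v b) $ i = rayleigh A b * b $ i" for i
      using arg_cong[OF eigenbasisD(4)[OF B b(1)], of "\<lambda>x. x $ i"] by simp
    then show ?thesis
      by (simp add: vec_eq_iff matrix_vector_mult_def b(2) flip: of_real_mult of_real_sum)
  qed
  ultimately show "eigenvalue ?A c" unfolding eigenvalue_def by blast
qed

lemma eigenvalue_real_iff: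
  fixes A :: "real^'m^'m"
  assumes sym: "transpose A = A" and B: "eigenbasis A B"
  shows "eigenvalue A c \<longleftrightarrow> c \<in> rayleigh A ` B"
proof
  assume "eigenvalue A c"
  then obtain v where v: "v \<noteq> 0" "A *v v = c *s v" by (auto simp: eigenvalue_def)
  let ?v = "\<chi> i. complex_of_real (v $ i)"
  have "?v \<noteq> 0" using v by (auto simp: vec_eq_iff)
  moreover have "map_matrix complex_of_real A *v ?v = complex_of_real c *s ?v"
    using v(2) by (simp add: vec_eq_iff matrix_vector_mult_def flip: of_real_mult of_real_sum)
  ultimately have "eigenvalue (map_matrix complex_of_real A) (complex_of_real c)"
    unfolding eigenvalue_def by blast
  then show "c \<in> rayleigh A ` B" using eigenvalue_complex_iff[OF assms] by auto
next
  assume "c \<in> rayleigh A ` B"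
  then obtain b where b: "b \<in> B" "c = rayleigh A b" by auto
  moreover have "b \<noteq> 0" using eigenbasisD(3)[OF B b(1)] by auto
  ultimately show "eigenvalue A c"
    using eigenbasisD(4)[OF B b(1)] by (auto simp: eigenvalue_def scalar_mult_eq_scaleR)
qed

lemma spectral_radius_bound:
  fixes A :: "real^'m^'m"
  assumes sym: "transpose A = A" and B: "eigenbasis A B" and b: "b \<in> B"
  shows "\<bar>rayleigh A b\<bar> \<le> spectral_radius A"
proof -
  have "{cmod c | c. eigenvalue (map_matrix complex_of_real A) c} =
      cmod ` complex_of_real ` rayleigh A ` B"
    unfolding eigenvalue_complex_iff[OF sym B] by blast
  moreover have "\<bar>rayleigh A b\<bar> = cmod (complex_of_real (rayleigh A b))" by simp
  ultimately show ?thesis unfolding spectral_radius_def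
    using b eigenbasisD(1)[OF B] by (metis Max_ge finite_imageI imageI)
qed

lemma min_eigenvalue_eigenbasis:
  fixes A :: "real^'m^'m"
  assumes sym: "transpose A = A" and B: "eigenbasis A B"
  shows "min_eigenvalue A = Min (rayleigh A ` B)"
  by (simp add: min_eigenvalue_def eigenvalue_real_iff[OF assms])

section \<open>Evaluation and degree of polynomial matrices\<close>

lemma transpose_mat_eval: "transpose (mat_eval G x) = mat_eval (transpose G) x"
  by (simp add: mat_eval_def transpose_def vec_eq_iff)

lemma mat_eval_nth [simp]: "mat_eval G x $ i $ j = meval (G $ i $ j) x"
  by (simp add: mat_eval_def)

lemma mat_eval_pow: "mat_eval (mat_pow G k) x = mat_pow (mat_eval G x) k"
  by (induction k) (auto simp: vec_eq_iff matrix_matrix_mult_def mat_def)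

lemma mat_eval_poly_mat:
  "mat_eval (poly_mat h G) x = (\<Sum>i\<le>degree h. coeff h i *\<^sub>R mat_pow (mat_eval G x) i)"
proof -
  have "meval (mat_pow G k $ i $ j) x = mat_pow (mat_eval G x) k $ i $ j" for k i j
    by (simp flip: mat_eval_pow)
  then show ?thesis by (simp add: vec_eq_iff poly_mat_def sum_component)
qed

lemma meval_mat_inner: "meval (mat_inner F G) x = mat_inner (mat_eval F x) (mat_eval G x)"
  by (simp add: mat_inner_def trace_def matrix_matrix_mult_def transpose_def)

lemma mat_pow_eigenvector:
  fixes A :: "real^'m^'m"
  assumes "A *v b = l *\<^sub>R b"
  shows "mat_pow A k *v b = l ^ k *\<^sub>R b"
proof (induction k)
  case (Suc k)
  then show ?case using assms
    by (simp add: matrix_vector_mult_scaleR mult.commute flip: matrix_vector_mul_assoc)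
qed simp

lemma matrix_vector_mult_sum_rdistrib: "(\<Sum>i\<in>I. A i) *v x = (\<Sum>i\<in>I. A i *v x)"
  by (induction I rule: infinite_finite_induct) (auto simp: matrix_vector_mult_add_rdistrib)

text \<open>The trace is taken in an eigenbasis of \<open>G(x)\<close>, whose vectors are also
  eigenvectors of \<open>H = h(G(x))\<close>. The transpose moves to the other side of the inner
  product, leaving \<open>(A b) \<bullet> (H b)\<close>.\<close>

lemma meval_mat_inner_poly_mat:
  fixes G :: "'n::finite mpoly^'m^'m"
  assumes B: "eigenbasis (mat_eval G x) B"
  shows "meval (mat_inner (poly_mat h G) G) x =
    (\<Sum>b\<in>B. poly h (rayleigh (mat_eval G x) b) * rayleigh (mat_eval G x) b)"
proof -
  let ?A = "mat_eval G x"
  define H where "H = (\<Sum>i\<le>degree h. coeff h i *\<^sub>R mat_pow ?A i)"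
  have "meval (mat_inner (poly_mat h G) G) x = (\<Sum>b\<in>B. b \<bullet> ((transpose H ** ?A) *v b))"
    unfolding meval_mat_inner mat_eval_poly_mat mat_inner_def[where 'a = real] H_def
    by (rule eigenbasis_trace[OF B])
  also have "\<dots> = (\<Sum>b\<in>B. poly h (rayleigh ?A b) * rayleigh ?A b)"
  proof (rule sum.cong)
    fix b assume b: "b \<in> B"
    note Ab = eigenbasisD(4)[OF B b]
    have "H *v b = (\<Sum>i\<le>degree h. coeff h i *\<^sub>R (mat_pow ?A i *v b))"
      unfolding H_def by (simp add: matrix_vector_mult_sum_rdistrib scaleR_matrix_vector_assoc)
    also have "\<dots> = poly h (rayleigh ?A b) *\<^sub>R b"
      by (simp add: mat_pow_eigenvector[OF Ab] poly_altdef scaleR_sum_left)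
    finally have H: "H *v b = poly h (rayleigh ?A b) *\<^sub>R b" .
    have "b \<bullet> ((transpose H ** ?A) *v b) = b \<bullet> ((?A *v b) v* H)"
      by (simp flip: matrix_vector_mul_assoc)
    also have "\<dots> = (?A *v b) \<bullet> (H *v b)"
      by (subst inner_commute) (rule dot_lmul_matrix)
    also have "\<dots> = poly h (rayleigh ?A b) * rayleigh ?A b"
      unfolding H Ab using eigenbasisD(3)[OF B b] by simp
    finally show "b \<bullet> ((transpose H ** ?A) *v b) = poly h (rayleigh ?A b) * rayleigh ?A b" .
  qed simp
  finally show ?thesis .
qed

lemma mdeg_entry_le: "mdeg (G $ i $ j) \<le> mat_deg G"
proof -
  have "{mdeg (G $ i $ j) | i j. True} = (\<lambda>(i, j). mdeg (G $ i $ j)) ` UNIV" by auto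
  then show ?thesis unfolding mat_deg_def by (intro Max_ge) auto
qed

lemma mdeg_mat_pow: "mdeg (mat_pow G k $ i $ j) \<le> k * mat_deg G"
proof (induction k arbitrary: i j)
  case (Suc k)
  show ?case
    by (simp add: matrix_matrix_mult_def)
       (intro mdeg_sum_le mdeg_mult_le mdeg_entry_le Suc)
qed (auto simp: mat_def)

text \<open>The extra 1 is the outer factor \<open>G\<close>; it is the source of
  \<open>v + 1\<close> in the degree \<open>2 * l * (v + 1)\<close>.\<close>

lemma mdeg_mat_inner_poly_mat:
  "mdeg (mat_inner (poly_mat h G) G) \<le> (degree h + 1) * mat_deg G"
proof -
  have "mdeg (poly_mat h G $ i $ j) \<le> degree h * mat_deg G" for i j
  proof -
    have "mdeg (mconst (coeff h k) * mat_pow G k $ i $ j) \<le> 0 + degree h * mat_deg G"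
      if "k \<le> degree h" for k
      using mdeg_mat_pow[of G k i j] that
      by (intro mdeg_mult_le) (auto intro: order.trans mult_right_mono)
    then show ?thesis by (auto simp: poly_mat_def sum_component intro!: mdeg_sum_le)
  qed
  then have "mdeg (mat_inner (poly_mat h G) G) \<le> degree h * mat_deg G + mat_deg G"
    unfolding mat_inner_def trace_def matrix_matrix_mult_def transpose_def
    by (simp, intro mdeg_sum_le mdeg_mult_le mdeg_entry_le)
  then show ?thesis by simp
qed

lemma mat_deg_le_half_deg: "mat_deg G \<le> 2 * half_deg G"
  unfolding half_deg_def by linarith

section \<open>The penalised objective\<close>

lemma sos_nonneg: "sos p \<Longrightarrow> 0 \<le> meval p x"
proof -
  have "0 \<le> meval (\<Sum>q\<leftarrow>qs. q ^ 2) x" for qs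
    by (induction qs) auto
  then show "sos p \<Longrightarrow> 0 \<le> meval p x" by (auto simp: sos_def)
qed

lemma Q_ball_nonneg:
  assumes "q \<in> Q_ball r" "x \<in> unit_ball"
  shows "0 \<le> meval q x"
proof -
  have "(\<Sum>i\<in>UNIV. (x $ i) ^ 2) = norm x ^ 2"
    unfolding power2_norm_eq_inner inner_vec_def by (simp add: power2_eq_square)
  also have "\<dots> \<le> 1" using assms(2) by (simp add: power_le_one)
  finally show ?thesis using assms(1) by (auto simp: Q_ball_def sos_nonneg)
qed

lemma rayleigh_range:
  assumes "transpose G = G" "spectral_radius (mat_eval G x) \<le> 1"
    and "eigenbasis (mat_eval G x) B" "b \<in> B"
  shows "rayleigh (mat_eval G x) b \<in> {-1..1}"
proof -
  have "\<bar>rayleigh (mat_eval G x) b\<bar> \<le> 1"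
    using spectral_radius_bound[of "mat_eval G x" B b] assms by (simp add: transpose_mat_eval)
  then show ?thesis by auto
qed

text \<open>On the feasible set the eigenvalues lie in \<open>[0, 1]\<close>, so every term
  \<open>h(\<lambda>) \<lambda>\<close> is nonnegative.\<close>

lemma H_mat_nonneg:
  assumes "transpose G = G" "spectral_radius (mat_eval G x) \<le> 1"
    and "p \<in> H_mat G k" "psd (mat_eval G x)"
  shows "0 \<le> meval p x"
proof -
  obtain h where h: "p = mat_inner (poly_mat h G) G" "\<And>t. t \<in> {-1..1} \<Longrightarrow> 0 \<le> poly h t"
    using assms(3) by (auto simp: H_mat_def)
  obtain B where B: "eigenbasis (mat_eval G x) B"
    using ex_eigenbasis[of "mat_eval G x"] assms(1) by (auto simp: transpose_mat_eval)
  have "0 \<le> rayleigh (mat_eval G x) b" for b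
    using assms(4) by (simp add: psd_def rayleigh_def)
  then show ?thesis
    unfolding h(1) meval_mat_inner_poly_mat[OF B]
    by (intro sum_nonneg mult_nonneg_nonneg h(2) rayleigh_range[OF assms(1,2) B])
qed

lemma lb_le_min_on:
  assumes "S \<noteq> {}" "\<And>p x. p \<in> Q \<Longrightarrow> x \<in> S \<Longrightarrow> 0 \<le> meval p x"
  shows "lb f Q \<le> ereal (min_on S f)"
  unfolding lb_def
proof (rule Sup_least, clarify)
  fix t assume "f - mconst t \<in> Q"
  then have "t \<le> meval f x" if "x \<in> S" for x using assms(2)[of _ x] that by fastforce
  then show "ereal t \<le> ereal (min_on S f)"
    unfolding min_on_def using assms(1) by (simp add: cINF_greatest)
qed

text \<open>A nonnegative eigenvalue costs at most \<open>c * \<eta>\<close> and a negative one only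
  lowers the sum. One below \<open>- \<delta>\<close> contributes at most
  \<open>c * \<delta> * \<eta> - c * \<delta>\<close>, and \<open>\<delta> \<le> 1\<close> lets its
  error share the budget \<open>c * \<eta>\<close>.\<close>

lemma penalty_sum_bounds:
  fixes l :: "'b \<Rightarrow> real" and h :: "real poly"
  assumes B: "finite B" "card B \<le> m" and l: "\<And>b. b \<in> B \<Longrightarrow> l b \<in> {-1..1}"
    and \<delta>: "0 < \<delta>" "\<delta> \<le> 1" and c: "0 \<le> c" and \<eta>: "0 \<le> \<eta>"
    and h01: "\<And>t. t \<in> {-1..1} \<Longrightarrow> 0 \<le> poly h t \<and> poly h t \<le> 1"
    and small: "\<And>t. t \<in> {0..1} \<Longrightarrow> poly h t \<le> \<eta>"
    and large: "\<And>t. t \<in> {-1..-\<delta>} \<Longrightarrow> 1 - \<eta> \<le> poly h t"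
  defines "s \<equiv> (\<Sum>b\<in>B. c * poly h (l b) * l b)"
  shows "s \<le> real m * (c * \<eta>)" "- (real m * c) \<le> s"
    "\<exists>b\<in>B. l b < - \<delta> \<Longrightarrow> s \<le> real m * (c * \<eta>) - c * \<delta>"
proof -
  have up: "c * poly h (l b) * l b \<le> c * \<eta>" if b: "b \<in> B" for b
  proof (cases "0 \<le> l b")
    case True
    have "poly h (l b) * l b \<le> \<eta> * 1"
      using True l[OF b] h01[OF l[OF b]] small[of "l b"] \<eta> by (intro mult_mono) auto
    then show ?thesis using c by (simp add: mult_left_mono mult.assoc)
  next
    case False
    then have "c * poly h (l b) * l b \<le> 0"
      using h01[OF l[OF b]] c by (intro mult_nonneg_nonpos) auto
    also have "0 \<le> c * \<eta>" using c \<eta> by simp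
    finally show ?thesis .
  qed
  have mono: "real (card C) * (c * \<eta>) \<le> real k * (c * \<eta>)" if "card C \<le> k" for C :: "'b set" and k
    using that c \<eta> by (intro mult_right_mono) auto
  show "s \<le> real m * (c * \<eta>)"
    unfolding s_def by (rule order.trans[OF sum_bounded_above[OF up] mono[OF B(2)]])
  have "- c \<le> c * poly h (l b) * l b" if b: "b \<in> B" for b
  proof -
    have "\<bar>poly h (l b) * l b\<bar> \<le> 1 * 1"
      unfolding abs_mult using h01[OF l[OF b]] l[OF b] by (intro mult_mono) auto
    then have "c * (- 1) \<le> c * (poly h (l b) * l b)" using c by (intro mult_left_mono) auto
    then show ?thesis by (simp add: mult.assoc)
  qed
  then have "real (card B) * (- c) \<le> s"
    unfolding s_def by (rule sum_bounded_below)
  moreover have "real (card B) * c \<le> real m * c" using B(2) c by (intro mult_right_mono) auto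
  ultimately show "- (real m * c) \<le> s" by simp
  assume "\<exists>b\<in>B. l b < - \<delta>"
  then obtain b where b: "b \<in> B" "l b < - \<delta>" by blast
  have "c * \<delta> * (1 - \<eta>) \<le> c * \<delta> * poly h (l b)"
    using large[of "l b"] l[OF b(1)] b(2) c \<delta> by (intro mult_left_mono) auto
  also have "\<dots> = c * poly h (l b) * \<delta>" by simp
  also have "\<dots> \<le> c * poly h (l b) * (- l b)"
    using h01[OF l[OF b(1)]] b(2) c by (intro mult_left_mono) auto
  finally have "c * poly h (l b) * l b \<le> c * \<delta> * \<eta> - c * \<delta>" by (simp add: algebra_simps)
  moreover have "c * \<delta> * \<eta> \<le> c * \<eta>" using \<delta> c \<eta> by (simp add: mult_left_le mult_right_mono)
  moreover have "(\<Sum>b\<in>B - {b}. c * poly h (l b) * l b) \<le> real (m - 1) * (c * \<eta>)"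
  proof -
    have "(\<Sum>b\<in>B - {b}. c * poly h (l b) * l b) \<le> real (card (B - {b})) * (c * \<eta>)"
      by (intro sum_bounded_above up) auto
    also have "\<dots> \<le> real (m - 1) * (c * \<eta>)"
      using B b(1) by (intro mono) simp
    finally show ?thesis .
  qed
  moreover have "s = c * poly h (l b) * l b + (\<Sum>b\<in>B - {b}. c * poly h (l b) * l b)"
    unfolding s_def by (rule sum.remove[OF B(1) b(1)])
  moreover have "m \<ge> 1" using B b(1) by (metis One_nat_def Suc_leI card_gt_0_iff empty_iff le_trans)
  then have "real m * (c * \<eta>) = c * \<eta> + real (m - 1) * (c * \<eta>)"
    by (simp add: of_nat_diff algebra_simps)
  ultimately show "s \<le> real m * (c * \<eta>) - c * \<delta>" by linarith
qed

text \<open>A coordinate function has positive range on the ball, so the two-sided estimate for it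
  fixes the sign of the constant.\<close>

lemma Slot_constant_nonneg:
  fixes K :: real
  assumes "0 < s" "\<And>g :: 'n::finite mpoly. mdeg g \<le> 1 \<Longrightarrow>
      0 \<le> ereal (min_on unit_ball g) - lb g (Q_ball s) \<and>
      ereal (min_on unit_ball g) - lb g (Q_ball s) \<le> ereal (K * (max_on unit_ball g - min_on unit_ball g))"
  shows "0 \<le> K"
proof -
  define g where "g = (mvar undefined :: 'n mpoly)"
  have "0 \<le> ereal (K * (max_on unit_ball g - min_on unit_ball g))"
    using assms(2)[of g] mdeg_mvar order.trans unfolding g_def by blast
  then have "0 \<le> K * (max_on unit_ball g - min_on unit_ball g)" by simp
  moreover have "min_on unit_ball g \<le> - 1" "1 \<le> max_on unit_ball g"
    using min_on_le[of "- axis undefined 1" unit_ball g] le_max_on[of "axis undefined 1" unit_ball g]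
    by (simp_all add: g_def)
  ultimately show ?thesis by (simp add: zero_le_mult_iff)
qed

theorem theorem4p2:
  fixes f :: "'n::finite mpoly" and G :: "'n mpoly^'m::finite^'m"
    and C_B :: "nat \<Rightarrow> nat \<Rightarrow> real"
    and X :: "(real^'n) set"
    and d l r v D :: nat and f_min L_f C L \<delta> U :: real
  assumes Slot: "\<And>E (g :: 'n mpoly) s.
        mdeg g \<le> E \<Longrightarrow> s \<ge> 2 * CARD('n) * E \<Longrightarrow>
          0 \<le> ereal (min_on unit_ball g) - lb g (Q_ball s) \<and>
          ereal (min_on unit_ball g) - lb g (Q_ball s)
            \<le> ereal (C_B CARD('n) E / real s ^ 2 * (max_on unit_ball g - min_on unit_ball g))"
    and d: "d = mdeg f"
    and G_sym: "transpose G = G"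
    and l: "l = half_deg G" "l \<ge> 1"
    and X: "X = feasible_set G" "X \<noteq> {}"
    and f_min: "f_min = min_on X f"
    and spectral: "\<forall>x\<in>unit_ball. spectral_radius (mat_eval G x) \<le> 1"
    and Lipschitz: "L_f-lipschitz_on unit_ball (meval f)"
    and Loja: "C > 0" "0 < L" "L \<le> 1"
      "\<forall>x\<in>unit_ball. infdist x X \<le> C * max 0 (- min_eigenvalue (mat_eval G x)) powr L"
    and delta: "0 < \<delta>" "\<delta> \<le> 1"
    and rv: "r > 0" "v > 0" "r \<ge> 2 * CARD('n) * D"
    and D: "D = max d (2 * l * (v + 1))"
    and U: "U = U_err (ball_norm f) CARD('m) v \<delta>"
  shows "lb f (Q_mat G r) \<le> ereal f_min \<and>
         ereal f_min - lb f (Q_mat G r)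
           \<le> ereal (2 * (ball_norm f * (1 + real CARD('m) / \<delta>) + U) * (C_B CARD('n) D / real r ^ 2)
                    + U + C * L_f * \<delta> powr L)"
proof -
  define M where "M = ball_norm f"
  define \<eta> where "\<eta> = 8 * exp 1 ^ 2 * exp (- 1 / (2 * exp 1 + 1)) powr (\<delta> * real v)"
  \<comment> \<open>The height gives \<open>c * \<delta> = 2 * M\<close>, enough to lift
    \<open>g\<close> from \<open>- M\<close> to \<open>M\<close> up to the error;
    \<open>m * c * \<eta>\<close> is then exactly \<open>U\<close>.\<close>
  define c where "c = 2 * M / \<delta>"
  have X_ball: "X \<subseteq> unit_ball" and X_psd: "\<And>x. x \<in> X \<Longrightarrow> psd (mat_eval G x)"
    by (auto simp: X(1) feasible_set_def)
  have M0: "0 \<le> M" using meval_le_ball_norm[of 0 f] by (simp add: M_def)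
  have \<eta>0: "0 \<le> \<eta>" by (simp add: \<eta>_def)
  have c0: "0 \<le> c" and c\<delta>: "c * \<delta> = 2 * M" using M0 delta by (simp_all add: c_def)
  have U_eq: "U = real CARD('m) * (c * \<eta>)"
    by (simp add: U U_err_def c_def \<eta>_def M_def)
  have U0: "0 \<le> U" using c0 \<eta>0 by (simp add: U_eq)
  have L_f: "0 \<le> L_f" using lipschitz_on_nonneg[OF Lipschitz] .

  obtain h where h: "degree h \<le> v"
    "\<And>t. t \<in> {-1..1} \<Longrightarrow> 0 \<le> poly h t \<and> poly h t \<le> 1"
    "\<And>t. t \<in> {0..1} \<Longrightarrow> poly h t \<le> \<eta>" "\<And>t. t \<in> {-1..-\<delta>} \<Longrightarrow> 1 - \<eta> \<le> poly h t"
    using step_poly[OF delta, of v] rv(2) unfolding \<eta>_def by auto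
  define p where "p = mat_inner (poly_mat (smult c h) G) G"
  define g where "g = f - p"

  have v_le: "2 * l * (v + 1) \<le> D" by (simp add: D)
  \<comment> \<open>There is at least one variable, so \<open>D \<le> r\<close> and thus
    \<open>l * (v + 1) \<le> r\<close>: after the shift by -1 the degree bound of
    \<open>H_mat\<close> still admits v.\<close>
  have "D \<le> 2 * CARD('n) * D" by simp
  also have "\<dots> \<le> r" by (rule rv(3))
  finally have "D \<le> r" .
  have deg_ch: "degree (smult c h) \<le> v" using degree_smult_le h(1) by (rule order.trans)
  have p_H: "p \<in> H_mat G (\<lfloor>real r / real (half_deg G)\<rfloor> - 1)"
  proof -
    have "l * (v + 1) \<le> r" using v_le \<open>D \<le> r\<close> by linarith
    then have "real l * (real v + 1) \<le> real r" by (metis of_nat_1 of_nat_add of_nat_le_iff of_nat_mult)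
    then have "real v + 1 \<le> real r / real (half_deg G)" using l by (simp add: field_simps)
    then have "int v \<le> \<lfloor>real r / real (half_deg G)\<rfloor> - 1" by linarith
    then show ?thesis
      unfolding p_def H_mat_def using deg_ch h(2) c0 by (intro CollectI exI[of _ "smult c h"]) auto
  qed
  have "mdeg p \<le> D"
  proof -
    have "mdeg p \<le> (degree (smult c h) + 1) * mat_deg G"
      unfolding p_def by (rule mdeg_mat_inner_poly_mat)
    also have "\<dots> \<le> (v + 1) * (2 * l)"
      using deg_ch mat_deg_le_half_deg[of G] l(1) by (intro mult_mono) auto
    also have "\<dots> \<le> D" using v_le by (simp add: mult_ac)
    finally show ?thesis .
  qed
  then have deg_g: "mdeg g \<le> D" unfolding g_def by (intro mdeg_diff_le) (simp_all add: D d)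

  have lb_le: "lb f (Q_mat G r) \<le> ereal f_min"
    unfolding f_min
  proof (rule lb_le_min_on[OF X(2)])
    fix q x assume "q \<in> Q_mat G r" "x \<in> X"
    then show "0 \<le> meval q x"
      using Q_ball_nonneg H_mat_nonneg[OF G_sym] X_ball X_psd spectral
      unfolding Q_mat_def by (force intro: add_nonneg_nonneg)
  qed

  have f_min_le: "f_min \<le> M"
  proof -
    obtain x where "x \<in> X" using X(2) by blast
    then show ?thesis using min_on_le[of x X f] meval_le_ball_norm[of x f] X_ball
      unfolding f_min M_def by fastforce
  qed
  have g_bounds: "meval g x \<le> M + real CARD('m) * c" "- M - U \<le> meval g x"
    "f_min - U - C * L_f * \<delta> powr L \<le> meval g x" if x: "x \<in> unit_ball" for x
  proof -
    let ?A = "mat_eval G x"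
    have sym: "transpose ?A = ?A" by (simp add: transpose_mat_eval G_sym)
    obtain B where B: "eigenbasis ?A B" using ex_eigenbasis[OF sym] .
    have range: "rayleigh ?A b \<in> {-1..1}" if "b \<in> B" for b
      using rayleigh_range[OF G_sym spectral[rule_format, OF x] B that] .
    define s where "s = (\<Sum>b\<in>B. c * poly h (rayleigh ?A b) * rayleigh ?A b)"
    have g: "meval g x = meval f x - s"
      by (simp add: g_def p_def s_def meval_mat_inner_poly_mat[OF B])
    note bounds = penalty_sum_bounds[where l = "rayleigh ?A", OF eigenbasisD(1,2)[OF B] range delta c0 \<eta>0 h(2-4),
      folded s_def U_eq, unfolded c\<delta>]
    have fx: "- M \<le> meval f x" "meval f x \<le> M"
      using meval_le_ball_norm[OF x, of f] by (simp_all add: M_def abs_le_iff)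
    show "meval g x \<le> M + real CARD('m) * c" "- M - U \<le> meval g x"
      using fx bounds(1,2) by (simp_all add: g)
    have err0: "0 \<le> C * L_f * \<delta> powr L" using Loja(1) L_f by simp
    show "f_min - U - C * L_f * \<delta> powr L \<le> meval g x"
    proof (cases "\<exists>b\<in>B. rayleigh ?A b < - \<delta>")
      case True
      then show ?thesis using bounds(3) fx f_min_le err0 by (simp add: g)
    next
      case False
      then have "- \<delta> \<le> min_eigenvalue ?A"
        unfolding min_eigenvalue_eigenbasis[OF sym B]
        using eigenbasisD(1)[OF B] eigenbasis_nonempty[OF B] by (subst Min_ge_iff) force+
      then have "max 0 (- min_eigenvalue ?A) powr L \<le> \<delta> powr L"
        using delta Loja(2) by (intro powr_mono2) auto
      then have "infdist x X \<le> C * \<delta> powr L"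
        using Loja(1) Loja(4)[rule_format, OF x] by (meson mult_left_mono less_imp_le order.trans)
      then have "L_f * infdist x X \<le> C * L_f * \<delta> powr L"
        using mult_left_mono[of "infdist x X" "C * \<delta> powr L" L_f] L_f by (simp add: mult_ac)
      moreover have "f_min - L_f * infdist x X \<le> meval f x"
        unfolding f_min using min_on_le[OF _ X_ball]
        by (intro lipschitz_infdist_lower[OF Lipschitz x X_ball X(2)])
      ultimately show ?thesis using bounds(1) by (simp add: g)
    qed
  qed

  define K where "K = C_B CARD('n) D / real r ^ 2"
  define a where "a = min_on unit_ball g"
  define b where "b = max_on unit_ball g"
  have ball_ne: "(unit_ball :: (real^'n) set) \<noteq> {}" by simp
  have a: "- M - U \<le> a" "f_min - U - C * L_f * \<delta> powr L \<le> a"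
    unfolding a_def min_on_def by (intro cINF_greatest[OF ball_ne] g_bounds; assumption)+
  have b: "b \<le> M + real CARD('m) * c"
    unfolding b_def max_on_def by (intro cSUP_least[OF ball_ne] g_bounds)
  have "0 \<le> K"
  proof (rule Slot_constant_nonneg[OF rv(1)])
    fix q :: "'n mpoly"
    assume "mdeg q \<le> 1"
    \<comment> \<open>Linear polynomials thus fall under Slot's theorem with the degree bound
      \<open>D\<close>, hence with the very constant \<open>K\<close>.\<close>
    moreover have "1 \<le> D" using v_le l(2) by (cases l) auto
    ultimately show "0 \<le> ereal (min_on unit_ball q) - lb q (Q_ball r) \<and>
      ereal (min_on unit_ball q) - lb q (Q_ball r)
        \<le> ereal (K * (max_on unit_ball q - min_on unit_ball q))"
      unfolding K_def using rv(3) by (intro Slot) auto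
  qed
  \<comment> \<open>The range is at most \<open>2 * M + m * c + U\<close> with
    \<open>m * c = 2 * M * m / \<delta>\<close>; one further \<open>U\<close> is given away.\<close>
  have "b - a \<le> 2 * (M * (1 + real CARD('m) / \<delta>) + U)"
    using a(1) b U0 by (simp add: c_def algebra_simps)
  then have Kab: "K * (b - a) \<le> K * (2 * (M * (1 + real CARD('m) / \<delta>) + U))"
    using \<open>0 \<le> K\<close> by (rule mult_left_mono)

  have "0 \<le> ereal a - lb g (Q_ball r)" "ereal a - lb g (Q_ball r) \<le> ereal (K * (b - a))"
    using Slot[OF deg_g rv(3)] by (simp_all add: a_def b_def K_def)
  \<comment> \<open>The lower estimate excludes the value plus infinity of the bound, the upper one
    minus infinity.\<close>
  then obtain y where y: "lb g (Q_ball r) = ereal y" "a - y \<le> K * (b - a)"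
    by (cases "lb g (Q_ball r)") auto
  have "lb g (Q_ball r) \<le> lb f (Q_mat G r)"
    unfolding lb_def
  proof (rule Sup_subset_mono, clarify)
    fix t assume "g - mconst t \<in> Q_ball r"
    moreover have "f - mconst t = (g - mconst t) + p" by (simp add: g_def)
    ultimately show "\<exists>t'. ereal t = ereal t' \<and> f - mconst t' \<in> Q_mat G r"
      unfolding Q_mat_def using p_H by blast
  qed
  then obtain z where z: "lb f (Q_mat G r) = ereal z" "y \<le> z"
    using lb_le y(1) by (cases "lb f (Q_mat G r)") auto
  have "f_min - z \<le> 2 * (M * (1 + real CARD('m) / \<delta>) + U) * K + U + C * L_f * \<delta> powr L"
    using a(2) y(2) z(2) Kab by (simp add: mult.commute)
  then show ?thesis using lb_le z(1) by (simp add: M_def K_def)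
qed

end
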